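(* Let $H,K$ be real or complex Hilbert spaces and let $A$ be a densely defined linear operator from $H$ to $K$. The following statements are equivalent: (i) $A$ is closed; (ii) $\operatorname{ran} M_{A,A^*}=H\times K$; (iii) $\{(-A^*z,z): z\in\operatorname{dom}A^*\}^{\perp}\subseteq\operatorname{ran} M_{A,A^*}$.
   Context: Operators are (possibly unbounded) linear maps defined on a linear subspace; $A$ is closed if its graph is closed in $H\times K$. $\perp$ denotes orthogonal complement in the product Hilbert space $H\times K$. $M_{A,A^*}$ is the operator in $H\times K$ with domain $\operatorname{dom}A\times\operatorname{dom}A^*$ given by $M_{A,A^*}(x,y)=(x-A^*y,\;Ax+y)$. *)

theory Defs
  imports "HOL-Analysis.Analysis"
begin

text \<open>
  A complex inner product space is presented as an extension of its underlying real inner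
  product space, whose inner product is the real part of the complex one; hence the norm is
  \<open>sqrt (Re (cinner x x))\<close>, and topology and completeness are the library's. The inner product
  is linear in the first argument.
\<close>

class complex_inner = real_inner +
  fixes scaleC :: "complex \<Rightarrow> 'a \<Rightarrow> 'a" (infixr "*\<^sub>C" 75)
    and cinner :: "'a \<Rightarrow> 'a \<Rightarrow> complex"
  assumes scaleC_add_right: "a *\<^sub>C (x + y) = a *\<^sub>C x + a *\<^sub>C y"
    and scaleC_add_left: "(a + b) *\<^sub>C x = a *\<^sub>C x + b *\<^sub>C x"
    and scaleC_scaleC: "a *\<^sub>C b *\<^sub>C x = (a * b) *\<^sub>C x"
    and scaleC_of_real: "complex_of_real r *\<^sub>C x = r *\<^sub>R x"
    and cinner_commute: "cinner x y = cnj (cinner y x)"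
    and cinner_add_left: "cinner (x + y) z = cinner x z + cinner y z"
    and cinner_scaleC_left: "cinner (a *\<^sub>C x) y = a * cinner x y"
    and inner_eq_Re_cinner: "inner x y = Re (cinner x y)"

lemma vector_space_scaleC: "vector_space (scaleC :: complex \<Rightarrow> 'a \<Rightarrow> 'a::complex_inner)"
  by unfold_locales
    (simp_all add: scaleC_add_right scaleC_add_left scaleC_scaleC
      scaleC_of_real[of 1, simplified])

instantiation complex :: complex_inner
begin

definition scaleC_complex :: "complex \<Rightarrow> complex \<Rightarrow> complex"
  where "scaleC_complex a x = a * x"

definition cinner_complex :: "complex \<Rightarrow> complex \<Rightarrow> complex"
  where "cinner_complex x y = x * cnj y"

instance
  by standard
    (simp_all add: scaleC_complex_def cinner_complex_def inner_complex_def
      scaleR_conv_of_real algebra_simps)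

end

instantiation prod :: (complex_inner, complex_inner) complex_inner
begin

definition scaleC_prod :: "complex \<Rightarrow> 'a \<times> 'b \<Rightarrow> 'a \<times> 'b"
  where "scaleC_prod a p = (a *\<^sub>C fst p, a *\<^sub>C snd p)"

definition cinner_prod :: "'a \<times> 'b \<Rightarrow> 'a \<times> 'b \<Rightarrow> complex"
  where "cinner_prod p q = cinner (fst p) (fst q) + cinner (snd p) (snd q)"

instance
proof
  fix p q :: "'a \<times> 'b"
  show "cinner p q = cnj (cinner q p)"
    by (simp add: cinner_prod_def cinner_commute[of "fst p"] cinner_commute[of "snd p"])
qed (simp_all add: scaleC_prod_def cinner_prod_def scaleC_add_right scaleC_add_left
    scaleC_scaleC scaleC_of_real cinner_add_left cinner_scaleC_left inner_prod_def
    inner_eq_Re_cinner scaleR_prod_def algebra_simps)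

end

text \<open>The complex counterpart of \<^const>\<open>orthogonal_comp\<close>.\<close>

definition corthogonal_comp :: "'a::complex_inner set \<Rightarrow> 'a set"
  where "corthogonal_comp W = {x. \<forall>y\<in>W. cinner y x = 0}"

text \<open>
  A possibly unbounded operator is a partial map, so that \<^const>\<open>dom\<close>, \<^const>\<open>ran\<close> and
  \<^const>\<open>Map.graph\<close> are its domain, range and graph. Scalar multiplications and inner products
  are parameters, to serve the real and the complex case alike.
\<close>

definition linear_operator ::
    "('f::field \<Rightarrow> 'a::ab_group_add \<Rightarrow> 'a) \<Rightarrow> ('f \<Rightarrow> 'b::ab_group_add \<Rightarrow> 'b) \<Rightarrow> ('a \<rightharpoonup> 'b) \<Rightarrow> bool"
  where "linear_operator s t A \<longleftrightarrow>
    module.subspace s (dom A) \<and>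
    (\<forall>x\<in>dom A. \<forall>y\<in>dom A. the (A (x + y)) = the (A x) + the (A y)) \<and>
    (\<forall>c. \<forall>x\<in>dom A. the (A (s c x)) = t c (the (A x)))"

definition densely_defined :: "('a::topological_space \<rightharpoonup> 'b) \<Rightarrow> bool"
  where "densely_defined A \<longleftrightarrow> closure (dom A) = UNIV"

definition closed_operator :: "('a::topological_space \<rightharpoonup> 'b::topological_space) \<Rightarrow> bool"
  where "closed_operator A \<longleftrightarrow> closed (Map.graph A)"

text \<open>The value \<open>z\<close> below is unique when \<open>A\<close> is densely defined.\<close>

definition adjoint_operator ::
    "('a \<Rightarrow> 'a \<Rightarrow> 'f) \<Rightarrow> ('b \<Rightarrow> 'b \<Rightarrow> 'f) \<Rightarrow> ('a \<rightharpoonup> 'b) \<Rightarrow> ('b \<rightharpoonup> 'a)"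
  where "adjoint_operator ip iq A y =
    (if \<exists>z. \<forall>x\<in>dom A. iq (the (A x)) y = ip x z
     then Some (THE z. \<forall>x\<in>dom A. iq (the (A x)) y = ip x z)
     else None)"

definition M_operator ::
    "('a::ab_group_add \<rightharpoonup> 'b::ab_group_add) \<Rightarrow> ('b \<rightharpoonup> 'a) \<Rightarrow> ('a \<times> 'b \<rightharpoonup> 'a \<times> 'b)"
  where "M_operator A B = (\<lambda>(x, y).
    if x \<in> dom A \<and> y \<in> dom B then Some (x - the (B y), the (A x) + y) else None)"

end

theory Submission
  imports Defs
begin

text \<open>
  Write \<open>G\<close> for the graph of \<open>A\<close> and \<open>V\<close> for the set of all \<open>(-A\<^sup>*z, z)\<close>. Density of the domain
  gives \<open>V = G\<^sup>\<bottom>\<close>, while \<open>ran M = G + V\<close> by the very form of \<open>M\<close>. If \<open>G\<close> is closed, the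
  projection theorem yields \<open>G + V = H \<times> K\<close>. Conversely, let \<open>V\<^sup>\<bottom> \<subseteq> G + V\<close>. Since \<open>V\<^sup>\<bottom>\<close> is closed
  and contains \<open>G\<close>, a point \<open>p\<close> of the closure of \<open>G\<close> is \<open>g + v\<close> with \<open>g \<in> G\<close> and \<open>v \<in> V\<close>; then
  \<open>v = p - g\<close> lies in \<open>V \<inter> V\<^sup>\<bottom> = 0\<close>, so \<open>p \<in> G\<close>. A complex operator has the same graph, adjoint and
  orthogonal complements as the underlying real one, because all sets involved are invariant
  under multiplication by \<open>\<i>\<close>.
\<close>

section \<open>Orthogonal complements and projections in real inner product spaces\<close>

lemma closed_orthogonal_comp_real_inner: "closed (orthogonal_comp (W :: 'a::real_inner set))"
proof -
  have "orthogonal_comp W = (\<Inter>y\<in>W. {x. inner y x = 0})"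
    by (auto simp: orthogonal_comp_def orthogonal_def)
  also have "closed \<dots>"
    by (intro closed_INT ballI closed_Collect_eq continuous_intros)
  finally show ?thesis .
qed

text \<open>The near-minimisers of the distance from \<open>p\<close> form a decreasing sequence of
  nonempty closed subsets \<open>C n\<close> of \<open>S\<close>. Their diameters shrink by the
  parallelogram law, so completeness gives a common point, and its minimality forces
  orthogonality.\<close>

lemma orthogonal_projection_exists:
  fixes S :: "'a::{real_inner, complete_space} set"
  assumes S: "subspace S" and "closed S"
  shows "\<exists>s\<in>S. p - s \<in> orthogonal_comp S"
proof -
  define d where "d = (INF s\<in>S. (norm (p - s))\<^sup>2)"
  have S0: "S \<noteq> {}"
    using subspace_0[OF S] by auto
  have bdd: "bdd_below ((\<lambda>s. (norm (p - s))\<^sup>2) ` S)"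
    by (rule bdd_belowI[of _ 0]) auto
  have d_le: "d \<le> (norm (p - s))\<^sup>2" if "s \<in> S" for s
    unfolding d_def by (rule cINF_lower[OF bdd that])
  define C where "C n = S \<inter> {s. (norm (p - s))\<^sup>2 \<le> d + 1 / real (Suc n)}" for n
  have "\<exists>a. \<forall>n. a \<in> C n"
  proof (rule decreasing_closed_nest)
    show "closed (C n)" for n
      unfolding C_def
      by (intro closed_Int \<open>closed S\<close> closed_Collect_le continuous_intros)
    show "C n \<noteq> {}" for n
    proof -
      have "d < d + 1 / real (Suc n)" by simp
      then obtain s where "s \<in> S" "(norm (p - s))\<^sup>2 < d + 1 / real (Suc n)"
        unfolding d_def using cINF_less_iff[OF S0 bdd] by metis
      then show ?thesis by (auto simp: C_def intro!: less_imp_le)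
    qed
    show "C n \<subseteq> C m" if "m \<le> n" for m n
    proof -
      have "1 / real (Suc n) \<le> 1 / real (Suc m)"
        using that by (simp add: frac_le)
      then show ?thesis by (auto simp: C_def)
    qed
    show "\<exists>n. \<forall>x\<in>C n. \<forall>y\<in>C n. dist x y < e" if "e > 0" for e
    proof -
      \<comment> \<open>For \<open>x\<close> and \<open>y\<close> in \<open>C n\<close> the midpoint
        lies in \<open>S\<close>, at squared distance at least \<open>d\<close> from
        \<open>p\<close>; the parallelogram law then bounds the squared norm of \<open>x - y\<close>
        by \<open>4 / Suc n\<close>.\<close>
      have "e\<^sup>2 / 4 > 0" using that by simp
      then obtain n where n: "1 / real (Suc n) < e\<^sup>2 / 4"
        using nat_approx_posE by blast
      have "dist x y < e" if x: "x \<in> C n" and y: "y \<in> C n" for x y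
      proof -
        have "(1/2) *\<^sub>R (x + y) \<in> S"
          using x y S by (auto simp: C_def intro: subspace_add subspace_scale)
        note d_le[OF this]
        \<comment> \<open>the parallelogram law for \<open>p - x\<close> and \<open>p - y\<close>\<close>
        moreover have "(norm (x - y))\<^sup>2 =
            2 * (norm (p - x))\<^sup>2 + 2 * (norm (p - y))\<^sup>2 - 4 * (norm (p - (1/2) *\<^sub>R (x + y)))\<^sup>2"
        proof -
          define u v where "u = p - x" and "v = p - y"
          have "x - y = v - u" "p - (1/2) *\<^sub>R (x + y) = (1/2) *\<^sub>R (u + v)"
            by (simp_all add: u_def v_def scaleR_right_diff_distrib scaleR_add_right
                flip: scaleR_left_distrib)
          moreover have "(norm (v - u))\<^sup>2 =
              2 * (norm u)\<^sup>2 + 2 * (norm v)\<^sup>2 - 4 * (norm ((1/2) *\<^sub>R (u + v)))\<^sup>2"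
            unfolding power2_norm_eq_inner
            by (simp add: inner_add_left inner_add_right inner_diff_left inner_diff_right
                inner_commute[of u v] field_simps)
          ultimately show ?thesis by (simp add: u_def v_def)
        qed
        ultimately have "(norm (x - y))\<^sup>2 \<le> 4 * (1 / real (Suc n))"
          using x y unfolding C_def by auto
        also have "\<dots> < e\<^sup>2" using n by simp
        finally have "norm (x - y) < e"
          using \<open>e > 0\<close> by (simp add: power2_less_imp_less)
        then show ?thesis by (simp add: dist_norm)
      qed
      then show ?thesis by blast
    qed
  qed blast
  then obtain s where s: "\<And>n. s \<in> C n" by blast
  then have "s \<in> S" by (auto simp: C_def)
  have le: "(norm (p - s))\<^sup>2 \<le> d"
  proof (rule field_le_epsilon)
    fix e :: real assume "e > 0"
    then obtain n where "1 / real (Suc n) < e" using nat_approx_posE by blast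
    then show "(norm (p - s))\<^sup>2 \<le> d + e" using s[of n] by (simp add: C_def)
  qed
  have "inner g (p - s) = 0" if "g \<in> S" for g
  proof (cases "g = 0")
    case False
    \<comment> \<open>\<open>t *\<^sub>R g\<close> is the projection of \<open>p - s\<close> onto
      the line through \<open>g\<close>. Moving \<open>s\<close> by it would lower the squared
      distance by \<open>(inner g (p - s))\<^sup>2 / inner g g\<close>, which minimality forces to
      be 0.\<close>
    define t where "t = inner g (p - s) / inner g g"
    have pos: "inner g g > 0" using False by simp
    have "s + t *\<^sub>R g \<in> S"
      using S \<open>s \<in> S\<close> that by (intro subspace_add subspace_scale)
    from order_trans[OF le d_le[OF this]]
    have "(norm (p - s))\<^sup>2 \<le> (norm ((p - s) - t *\<^sub>R g))\<^sup>2"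
      by (simp add: algebra_simps)
    also have "\<dots> = (norm (p - s))\<^sup>2 - 2 * t * inner g (p - s) + t * (t * inner g g)"
      unfolding power2_norm_eq_inner
      by (simp add: inner_diff_left inner_diff_right inner_commute algebra_simps)
    also have "t * inner g g = inner g (p - s)"
      using pos by (simp add: t_def)
    finally have "t * inner g (p - s) \<le> 0" by simp
    then have "(inner g (p - s))\<^sup>2 / inner g g \<le> 0"
      by (simp add: t_def power2_eq_square)
    then show ?thesis
      using pos by (simp add: divide_le_0_iff)
  qed simp
  with \<open>s \<in> S\<close> show ?thesis
    by (auto simp: orthogonal_comp_def orthogonal_def)
qed

section \<open>Adjoint, graph and range of M over the reals\<close>

lemma adjoint_operator_eq_Some_iff:
  fixes A :: "'a::real_inner \<rightharpoonup> 'b::real_inner"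
  assumes "densely_defined A"
  shows "adjoint_operator inner inner A y = Some z \<longleftrightarrow>
    (\<forall>x\<in>dom A. inner (the (A x)) y = inner x z)"
proof -
  \<comment> \<open>Two candidates differ by a vector orthogonal to the dense domain, hence by
    continuity to everything, itself included. This makes \<open>THE\<close> well defined.\<close>
  have unique: "z = z'"
    if "\<forall>x\<in>dom A. inner (the (A x)) y = inner x z"
      and "\<forall>x\<in>dom A. inner (the (A x)) y = inner x z'" for z z'
  proof -
    have "dom A \<subseteq> {x. inner x (z - z') = 0}"
      using that by (simp add: subset_iff inner_diff_right del: domIff)
    moreover have "closed {x. inner x (z - z') = 0}"
      by (intro closed_Collect_eq continuous_intros)
    ultimately have "closure (dom A) \<subseteq> {x. inner x (z - z') = 0}"
      by (rule closure_minimal)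
    then have "inner (z - z') (z - z') = 0"
      using assms unfolding densely_defined_def by blast
    then show ?thesis by simp
  qed
  show ?thesis
  proof
    assume "\<forall>x\<in>dom A. inner (the (A x)) y = inner x z"
    then show "adjoint_operator inner inner A y = Some z"
      unfolding adjoint_operator_def using unique by (auto intro!: the_equality)
  next
    assume *: "adjoint_operator inner inner A y = Some z"
    then obtain z' where z': "\<forall>x\<in>dom A. inner (the (A x)) y = inner x z'"
      unfolding adjoint_operator_def by (auto split: if_splits)
    then have "(THE z. \<forall>x\<in>dom A. inner (the (A x)) y = inner x z) = z'"
      using unique by (intro the_equality) auto
    with * z' show "\<forall>x\<in>dom A. inner (the (A x)) y = inner x z"
      unfolding adjoint_operator_def by (auto split: if_splits)
  qed
qed

text \<open>Orthogonality of \<open>(w, z)\<close> to every \<open>(x, A x)\<close> reads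
  \<open>inner (A x) z = inner x (- w)\<close>, which is the condition for the adjoint to send
  \<open>z\<close> to \<open>- w\<close>.\<close>

lemma adjoint_graph_eq_orthogonal_comp:
  fixes A :: "'a::real_inner \<rightharpoonup> 'b::real_inner"
  assumes "densely_defined A"
  defines "A' \<equiv> adjoint_operator inner inner A"
  shows "{(- the (A' z), z) | z. z \<in> dom A'} = orthogonal_comp (Map.graph A)"
proof -
  have "(w, z) \<in> orthogonal_comp (Map.graph A) \<longleftrightarrow> A' z = Some (- w)" for w z
    unfolding A'_def adjoint_operator_eq_Some_iff[OF assms(1)]
    by (auto simp: orthogonal_comp_def orthogonal_def Map.graph_def dom_def
        eq_neg_iff_add_eq_0 add.commute)
  then show ?thesis by force
qed

text \<open>The value at \<open>(x, y)\<close> is \<open>(x, A x) + (- B y, y)\<close>, and the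
  domain is a product, so the two summands vary independently.\<close>

lemma ran_M_operator:
  "ran (M_operator A B) = {g + v | g v. g \<in> Map.graph A \<and> v \<in> {(- the (B z), z) | z. z \<in> dom B}}"
proof (rule set_eqI)
  fix p :: "'a \<times> 'b"
  have "p \<in> ran (M_operator A B) \<longleftrightarrow>
      (\<exists>x\<in>dom A. \<exists>y\<in>dom B. p = (x - the (B y), the (A x) + y))"
    by (auto simp: ran_def M_operator_def split: if_splits)
  also have "\<dots> \<longleftrightarrow> p \<in> {g + v | g v. g \<in> Map.graph A \<and> v \<in> {(- the (B z), z) | z. z \<in> dom B}}"
    by (force simp: Map.graph_def dom_def)
  finally show "p \<in> ran (M_operator A B) \<longleftrightarrow>
    p \<in> {g + v | g v. g \<in> Map.graph A \<and> v \<in> {(- the (B z), z) | z. z \<in> dom B}}" .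
qed

lemma subspace_graph:
  fixes A :: "'a::real_vector \<rightharpoonup> 'b::real_vector"
  assumes "linear_operator scaleR scaleR A"
  shows "subspace (Map.graph A)"
proof -
  have sub: "subspace (dom A)"
    using assms by (simp add: linear_operator_def subspace_raw_def)
  have graph: "(x, y) \<in> Map.graph A \<longleftrightarrow> x \<in> dom A \<and> the (A x) = y" for x y
    by (auto simp: Map.graph_def)
  have scale: "the (A (c *\<^sub>R x)) = c *\<^sub>R the (A x)" if "x \<in> dom A" for c x
    using assms that by (simp add: linear_operator_def)
  have add: "the (A (x + y)) = the (A x) + the (A y)" if "x \<in> dom A" "y \<in> dom A" for x y
    using assms that by (simp add: linear_operator_def)
  \<comment> \<open>Scaling by 0 gives \<open>A 0 = 0\<close>, which puts the origin in the
    graph.\<close>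
  show ?thesis
    unfolding subspace_def
    using subspace_0[OF sub] subspace_add[OF sub] subspace_scale[OF sub] add scale
      scale[OF subspace_0[OF sub], of 0]
    by (auto simp: graph zero_prod_def simp del: domIff)
qed

lemma real_operator_closed_iff_range:
  fixes A :: "'a::{real_inner, complete_space} \<rightharpoonup> 'b::{real_inner, complete_space}"
  assumes lin: "linear_operator scaleR scaleR A" and dense: "densely_defined A"
  defines "A' \<equiv> adjoint_operator inner inner A"
  defines "V \<equiv> {(- the (A' z), z) | z. z \<in> dom A'}"
  shows "closed_operator A \<longleftrightarrow> ran (M_operator A A') = UNIV"
    and "ran (M_operator A A') = UNIV \<longleftrightarrow> orthogonal_comp V \<subseteq> ran (M_operator A A')"
proof -
  let ?G = "Map.graph A" and ?R = "ran (M_operator A A')"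
  have V: "V = orthogonal_comp ?G"
    unfolding V_def A'_def by (rule adjoint_graph_eq_orthogonal_comp[OF dense])
  have R: "?R = {g + v | g v. g \<in> ?G \<and> v \<in> V}"
    unfolding V_def by (rule ran_M_operator)
  have G: "subspace ?G" by (rule subspace_graph[OF lin])
  have 1: "?R = UNIV" if "closed_operator A"
  proof -
    have "closed ?G" using that by (simp add: closed_operator_def)
    have "p \<in> ?R" for p
    proof -
      obtain g where "g \<in> ?G" "p - g \<in> V"
        using orthogonal_projection_exists[OF G \<open>closed ?G\<close>, of p] V by auto
      moreover have "p = g + (p - g)" by simp
      ultimately show ?thesis unfolding R by blast
    qed
    then show ?thesis by blast
  qed
  have 2: "closed_operator A" if sub: "orthogonal_comp V \<subseteq> ?R"
  proof -
    have GV: "?G \<subseteq> orthogonal_comp V"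
      unfolding V by (auto simp: orthogonal_comp_def orthogonal_commute)
    have "closure ?G \<subseteq> ?G"
    proof
      fix p assume "p \<in> closure ?G"
      then have p: "p \<in> orthogonal_comp V"
        using closure_minimal[OF GV closed_orthogonal_comp_real_inner] by blast
      then obtain g v where gv: "p = g + v" "g \<in> ?G" "v \<in> V"
        using sub R by blast
      have "orthogonal v p" "orthogonal v g"
        using p gv GV by (auto simp: orthogonal_comp_def)
      then have "v = 0"
        by (simp add: gv orthogonal_def inner_add_right)
      with gv show "p \<in> ?G" by simp
    qed
    then show ?thesis
      by (simp add: closed_operator_def closure_subset_eq)
  qed
  \<comment> \<open>Facts 1 and 2 close a cycle of implications, since a range equal to
    \<open>UNIV\<close> trivially contains the complement of \<open>V\<close>.\<close>
  show "closed_operator A \<longleftrightarrow> ?R = UNIV" "?R = UNIV \<longleftrightarrow> orthogonal_comp V \<subseteq> ?R"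
    using 1 2 by auto
qed

section \<open>Reduction of the complex case to the real one\<close>

lemma cinner_scaleC_right: "cinner x (a *\<^sub>C y) = cnj a * cinner x y"
  by (metis cinner_commute cinner_scaleC_left complex_cnj_mult)

text \<open>The real part of \<open>cinner (\<i> *\<^sub>C y) x\<close> is minus the imaginary part
  of \<open>cinner y x\<close>, so real orthogonality to both \<open>y\<close> and
  \<open>\<i> *\<^sub>C y\<close> is complex orthogonality to \<open>y\<close>.\<close>

lemma corthogonal_comp_eq_orthogonal_comp:
  assumes "\<And>x. x \<in> W \<Longrightarrow> \<i> *\<^sub>C x \<in> W"
  shows "corthogonal_comp W = orthogonal_comp W"
proof -
  have "cinner y x = 0" if "\<forall>y\<in>W. inner y x = 0" "y \<in> W" for x y
  proof -
    have "inner (\<i> *\<^sub>C y) x = 0" "inner y x = 0" using that assms by auto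
    then show ?thesis
      by (simp add: inner_eq_Re_cinner cinner_scaleC_left complex_eq_iff)
  qed
  then show ?thesis
    by (auto simp: corthogonal_comp_def orthogonal_comp_def orthogonal_def inner_eq_Re_cinner)
qed

text \<open>By the preceding lemma \<open>x\<close> is complex orthogonal to \<open>W\<close>, and a
  scalar on \<open>x\<close> only multiplies \<open>cinner y x\<close> by its conjugate.\<close>

lemma orthogonal_comp_scaleC_ii:
  assumes "\<And>x. x \<in> W \<Longrightarrow> \<i> *\<^sub>C x \<in> W" and "x \<in> orthogonal_comp W"
  shows "\<i> *\<^sub>C x \<in> orthogonal_comp W"
proof -
  have "cinner y x = 0" if "y \<in> W" for y
    using assms that corthogonal_comp_eq_orthogonal_comp[of W]
    by (auto simp: corthogonal_comp_def)
  then show ?thesis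
    by (simp add: orthogonal_comp_def orthogonal_def inner_eq_Re_cinner cinner_scaleC_right)
qed

lemma subspace_scaleC_iff:
  "module.subspace scaleC S \<longleftrightarrow>
    0 \<in> S \<and> (\<forall>x\<in>S. \<forall>y\<in>S. x + y \<in> S) \<and> (\<forall>c. \<forall>x\<in>S. c *\<^sub>C x \<in> S)"
  using vector_space_scaleC unfolding vector_space_def
  by (intro module.subspace_def) (simp add: module_def)

lemma linear_operator_scaleR_if_scaleC:
  assumes "linear_operator scaleC scaleC B"
  shows "linear_operator scaleR scaleR B"
proof -
  have "subspace (dom B)"
    using assms unfolding linear_operator_def subspace_scaleC_iff subspace_def
    by (metis scaleC_of_real)
  then show ?thesis
    using assms unfolding linear_operator_def subspace_raw_def by (metis scaleC_of_real)
qed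

lemma graph_scaleC:
  assumes "linear_operator scaleC scaleC B" and "p \<in> Map.graph B"
  shows "c *\<^sub>C p \<in> Map.graph B"
proof -
  obtain x where x: "x \<in> dom B" "p = (x, the (B x))"
    using assms(2) by (force simp: Map.graph_def)
  then have "c *\<^sub>C x \<in> dom B" "the (B (c *\<^sub>C x)) = c *\<^sub>C the (B x)"
    using assms(1) by (auto simp: linear_operator_def subspace_scaleC_iff simp del: domIff)
  then show ?thesis using x by (auto simp: Map.graph_def scaleC_prod_def)
qed

text \<open>Testing the real adjoint condition at \<open>x\<close> and at
  \<open>\<i> *\<^sub>C x\<close> compares the real and the imaginary parts, so both adjoints are
  defined by the same condition on \<open>y\<close> and \<open>z\<close>.\<close>

lemma adjoint_operator_cinner_eq_inner:
  assumes "linear_operator scaleC scaleC B"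
  shows "adjoint_operator cinner cinner B = adjoint_operator inner inner B"
proof -
  have "(\<forall>x\<in>dom B. cinner (the (B x)) y = cinner x z) \<longleftrightarrow>
      (\<forall>x\<in>dom B. inner (the (B x)) y = inner x z)" (is "?C \<longleftrightarrow> ?R") for y z
  proof
    assume ?R
    show ?C
    proof
      fix x assume x: "x \<in> dom B"
      then have "\<i> *\<^sub>C x \<in> dom B" "the (B (\<i> *\<^sub>C x)) = \<i> *\<^sub>C the (B x)"
        using assms by (auto simp: linear_operator_def subspace_scaleC_iff simp del: domIff)
      with \<open>?R\<close> x have "inner (\<i> *\<^sub>C the (B x)) y = inner (\<i> *\<^sub>C x) z"
        "inner (the (B x)) y = inner x z" by metis+
      then show "cinner (the (B x)) y = cinner x z"
        by (simp add: inner_eq_Re_cinner cinner_scaleC_left complex_eq_iff)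
    qed
  qed (simp add: inner_eq_Re_cinner)
  then show ?thesis by (simp add: adjoint_operator_def fun_eq_iff)
qed

theorem theorem2p3:
  fixes A :: "'h::{real_inner, complete_space} \<rightharpoonup> 'k::{real_inner, complete_space}"
    and B :: "'hc::{complex_inner, complete_space} \<rightharpoonup> 'kc::{complex_inner, complete_space}"
  shows "(linear_operator scaleR scaleR A \<and> densely_defined A \<longrightarrow>
      (let A' = adjoint_operator inner inner A; M = M_operator A A' in
        (closed_operator A \<longleftrightarrow> ran M = UNIV) \<and>
        (ran M = UNIV \<longleftrightarrow> orthogonal_comp {(- the (A' z), z) | z. z \<in> dom A'} \<subseteq> ran M))) \<and>
    (linear_operator scaleC scaleC B \<and> densely_defined B \<longrightarrow>
      (let B' = adjoint_operator cinner cinner B; M = M_operator B B' in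
        (closed_operator B \<longleftrightarrow> ran M = UNIV) \<and>
        (ran M = UNIV \<longleftrightarrow> corthogonal_comp {(- the (B' z), z) | z. z \<in> dom B'} \<subseteq> ran M)))"
proof (intro conjI impI; elim conjE)
  assume "linear_operator scaleR scaleR A" "densely_defined A"
  note real_operator_closed_iff_range[OF this]
  then show "let A' = adjoint_operator inner inner A; M = M_operator A A' in
      (closed_operator A \<longleftrightarrow> ran M = UNIV) \<and>
      (ran M = UNIV \<longleftrightarrow> orthogonal_comp {(- the (A' z), z) | z. z \<in> dom A'} \<subseteq> ran M)"
    unfolding Let_def by (rule conjI)
next
  assume lin: "linear_operator scaleC scaleC B" and dense: "densely_defined B"
  let ?B' = "adjoint_operator inner inner B"
  \<comment> \<open>Invariance under \<i> passes from the graph to its complement, which is the set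
    in braces; hence the real and complex complements of that set agree.\<close>
  have "corthogonal_comp {(- the (?B' z), z) | z. z \<in> dom ?B'} =
      orthogonal_comp {(- the (?B' z), z) | z. z \<in> dom ?B'}"
    unfolding adjoint_graph_eq_orthogonal_comp[OF dense]
    by (intro corthogonal_comp_eq_orthogonal_comp orthogonal_comp_scaleC_ii graph_scaleC[OF lin])
  then show "let B' = adjoint_operator cinner cinner B; M = M_operator B B' in
      (closed_operator B \<longleftrightarrow> ran M = UNIV) \<and>
      (ran M = UNIV \<longleftrightarrow> corthogonal_comp {(- the (B' z), z) | z. z \<in> dom B'} \<subseteq> ran M)"
    unfolding Let_def adjoint_operator_cinner_eq_inner[OF lin]
    using real_operator_closed_iff_range[OF linear_operator_scaleR_if_scaleC[OF lin] dense]
    by simp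
qed

end
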